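(* Let $G$ and $H$ be finite vertex-transitive graphs. Suppose there exists an induced subgraph $G'$ of $G$ such that $G'\times H$ is MIS-normal and $\frac{\alpha(G')}{|V(G')|}=\frac{\alpha(G)}{|V(G)|}$. Then at least one of the following holds: (i) $G\times H$ is MIS-normal; (ii) $\frac{\alpha(G)}{|V(G)|}=\frac{\alpha(H)}{|V(H)|}$ and $G$ is IS-imprimitive; (iii) $\frac{\alpha(G)}{|V(G)|}<\frac{\alpha(H)}{|V(H)|}$ and $G$ is disconnected.
   Context: Graphs are finite and simple. The direct product $X\times Y$ has vertex set $V(X)\times V(Y)$, with $(u_1,u_2)$ adjacent to $(v_1,v_2)$ iff $\{u_1,v_1\}\in E(X)$ and $\{u_2,v_2\}\in E(Y)$. $\alpha(\cdot)$ is the independence number. $X\times Y$ is MIS-normal if every maximum independent set of $X\times Y$ is of the form $I\times V(Y)$ with $I$ an independent set of $X$, or $V(X)\times I$ with $I$ an independent set of $Y$. For $A\subseteq V(X)$, $N_X[A]$ is $A$ together with all vertices adjacent to some vertex of $A$. For a vertex-transitive graph $X$, an independent set $A$ is imprimitive if $|A|<\alpha(X)$ and $\frac{|A|}{|N_X[A]|}=\frac{\alpha(X)}{|V(X)|}$; $X$ is IS-imprimitive if it has an imprimitive independent set, and IS-primitive otherwise. *)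

theory Defs
  imports "Graph_Theory.Digraph_Component"
begin

text \<open>
  Finite simple graphs are the \<^locale>\<open>pair_graph\<close>s of the library: finite vertex set,
  and a symmetric irreflexive arc relation on it.
\<close>

definition vertex_transitive :: "'a pair_pre_digraph \<Rightarrow> bool" where
  "vertex_transitive X \<longleftrightarrow>
    (\<forall>u \<in> pverts X. \<forall>v \<in> pverts X. \<exists>f.
       bij_betw f (pverts X) (pverts X) \<and>
       (\<forall>x \<in> pverts X. \<forall>y \<in> pverts X. (x, y) \<in> parcs X \<longleftrightarrow> (f x, f y) \<in> parcs X) \<and>
       f u = v)"

definition direct_product ::
    "'a pair_pre_digraph \<Rightarrow> 'b pair_pre_digraph \<Rightarrow> ('a \<times> 'b) pair_pre_digraph" where
  "direct_product X Y =
    \<lparr> pverts = pverts X \<times> pverts Y,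
      parcs = {((u1, u2), (v1, v2)) | u1 u2 v1 v2. (u1, v1) \<in> parcs X \<and> (u2, v2) \<in> parcs Y} \<rparr>"

definition independent_set :: "'a pair_pre_digraph \<Rightarrow> 'a set \<Rightarrow> bool" where
  "independent_set X I \<longleftrightarrow> I \<subseteq> pverts X \<and> (\<forall>u \<in> I. \<forall>v \<in> I. (u, v) \<notin> parcs X)"

definition independence_number :: "'a pair_pre_digraph \<Rightarrow> nat" where
  "independence_number X = Max (card ` {I. independent_set X I})"

definition maximum_independent_set :: "'a pair_pre_digraph \<Rightarrow> 'a set \<Rightarrow> bool" where
  "maximum_independent_set X I \<longleftrightarrow> independent_set X I \<and> card I = independence_number X"

text \<open>The ratio is 0 for the graph without vertices, and positive for all other finite graphs.\<close>

definition independence_ratio :: "'a pair_pre_digraph \<Rightarrow> real" where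
  "independence_ratio X = real (independence_number X) / real (card (pverts X))"

text \<open>MIS-normality is a property of the product together with its two factors.\<close>

definition MIS_normal :: "'a pair_pre_digraph \<Rightarrow> 'b pair_pre_digraph \<Rightarrow> bool" where
  "MIS_normal X Y \<longleftrightarrow>
    (\<forall>S. maximum_independent_set (direct_product X Y) S \<longrightarrow>
       (\<exists>I. independent_set X I \<and> S = I \<times> pverts Y) \<or>
       (\<exists>I. independent_set Y I \<and> S = pverts X \<times> I))"

definition closed_neighbourhood :: "'a pair_pre_digraph \<Rightarrow> 'a set \<Rightarrow> 'a set" where
  "closed_neighbourhood X A = A \<union> {v \<in> pverts X. \<exists>a \<in> A. (a, v) \<in> parcs X}"

text \<open>
  The empty set is never imprimitive: then the quotient on the left is \<open>0 / 0 = 0\<close>,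
  whereas the independence ratio of a graph with a vertex is positive (and in a graph
  without vertices no set satisfies the strict inequality).
\<close>

definition imprimitive_independent_set :: "'a pair_pre_digraph \<Rightarrow> 'a set \<Rightarrow> bool" where
  "imprimitive_independent_set X A \<longleftrightarrow>
    independent_set X A \<and> card A < independence_number X \<and>
    real (card A) / real (card (closed_neighbourhood X A)) = independence_ratio X"

definition IS_imprimitive :: "'a pair_pre_digraph \<Rightarrow> bool" where
  "IS_imprimitive X \<longleftrightarrow> (\<exists>A. imprimitive_independent_set X A)"

end

theory Submission
  imports Defs "HOL-Combinatorics.Permutations"
begin

text \<open>
  Let \<open>S\<close> be a maximum independent set of \<open>G \<times> H\<close>. Pulling \<open>S\<close> back to \<open>G' \<times> H\<close> along an
  automorphism of \<open>G\<close> gives an independent set, and averaging over all automorphisms shows that each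
  of these pullbacks is maximum. As \<open>G' \<times> H\<close> is MIS-normal, each fibre of \<open>S\<close> over a vertex of \<open>G\<close>
  is empty, all of \<open>V(H)\<close>, or a maximum independent set of \<open>H\<close>. Fibres of the last kind over adjacent
  vertices coincide, since their union is independent; hence a non-constant choice of such fibres
  splits \<open>G\<close> into unions of components. If fibres of both kinds occur, the set of vertices with full
  fibre is imprimitive, because all inequalities in the count of \<open>S\<close> are equalities.
\<close>

section \<open>Independent sets\<close>

lemma finite_independent_sets:
  assumes "finite (pverts X)"
  shows "finite {I. independent_set X I}"
  by (rule finite_subset[of _ "Pow (pverts X)"]) (auto simp: independent_set_def assms)

lemma card_le_independence_number:
  assumes "finite (pverts X)" "independent_set X I"
  shows "card I \<le> independence_number X"
  unfolding independence_number_def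
  by (rule Max_ge) (use assms finite_independent_sets in auto)

lemma ex_maximum_independent_set:
  assumes "finite (pverts X)"
  shows "\<exists>I. maximum_independent_set X I"
proof -
  have "independence_number X \<in> card ` {I. independent_set X I}"
    unfolding independence_number_def
  proof (rule Max_in)
    have "independent_set X {}" by (simp add: independent_set_def)
    then show "card ` {I. independent_set X I} \<noteq> {}" by blast
  qed (use assms finite_independent_sets in blast)
  then show ?thesis by (force simp: maximum_independent_set_def)
qed

lemma independence_number_le_card:
  assumes "finite (pverts X)"
  shows "independence_number X \<le> card (pverts X)"
proof -
  obtain I where "maximum_independent_set X I"
    using ex_maximum_independent_set[OF assms] by blast
  then show ?thesis
    by (metis assms card_mono independent_set_def maximum_independent_set_def)
qed

text \<open>Also valid without vertices: the quotient then has the default value 0, and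
  \<open>independence_number_le_card\<close> makes the left side 0 as well.\<close>

lemma independence_number_eq_ratio:
  assumes "finite (pverts X)"
  shows "real (independence_number X) = independence_ratio X * real (card (pverts X))"
  using assms independence_number_le_card[OF assms] by (auto simp: independence_ratio_def)

lemma independence_ratio_pos:
  assumes "finite (pverts X)" "pverts X \<noteq> {}" "\<And>v. (v, v) \<notin> parcs X"
  shows "independence_ratio X > 0"
proof -
  obtain v where "v \<in> pverts X" using assms by blast
  then have "independent_set X {v}" using assms by (simp add: independent_set_def)
  then have "independence_number X \<ge> 1" using card_le_independence_number[OF assms(1)] by fastforce
  moreover have "card (pverts X) > 0" using assms by (simp add: card_gt_0_iff)
  ultimately show ?thesis by (simp add: independence_ratio_def)
qed

text \<open>The union of the two sets is independent, so it has no more elements than either set and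
  equals both. This is later applied to fibres over adjacent vertices.\<close>

lemma maximum_independent_sets_eq:
  assumes "finite (pverts X)" "maximum_independent_set X I" "maximum_independent_set X J"
    and "\<And>u v. u \<in> I \<Longrightarrow> v \<in> J \<Longrightarrow> (u, v) \<notin> parcs X \<and> (v, u) \<notin> parcs X"
  shows "I = J"
proof -
  have "independent_set X (I \<union> J)"
    using assms by (auto simp: maximum_independent_set_def independent_set_def)
  moreover from this have "finite (I \<union> J)"
    using assms(1) by (meson finite_subset independent_set_def)
  ultimately show ?thesis
    using card_le_independence_number[OF assms(1)] assms(2,3)
    by (metis card_seteq maximum_independent_set_def sup_ge1 sup_ge2)
qed

section \<open>Averaging over automorphisms\<close>

text \<open>Since \<open>permutes\<close> fixes every point outside the vertex set, each
  automorphism is represented by exactly one function. The set is therefore finite and can be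
  averaged over.\<close>

definition automorphisms :: "'a pair_pre_digraph \<Rightarrow> ('a \<Rightarrow> 'a) set" where
  "automorphisms X = {f. f permutes pverts X \<and>
     (\<forall>x \<in> pverts X. \<forall>y \<in> pverts X. (x, y) \<in> parcs X \<longleftrightarrow> (f x, f y) \<in> parcs X)}"

lemma finite_automorphisms: "finite (pverts X) \<Longrightarrow> finite (automorphisms X)"
  by (rule finite_subset[OF _ finite_permutations[of "pverts X"]]) (auto simp: automorphisms_def)

lemma automorphism_in_pverts:
  "f \<in> automorphisms X \<Longrightarrow> x \<in> pverts X \<Longrightarrow> f x \<in> pverts X"
  by (simp add: automorphisms_def permutes_in_image)

lemma id_in_automorphisms: "id \<in> automorphisms X"
  by (simp add: automorphisms_def permutes_id)

lemma comp_in_automorphisms: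
  assumes "f \<in> automorphisms X" "g \<in> automorphisms X"
  shows "f \<circ> g \<in> automorphisms X"
  unfolding automorphisms_def mem_Collect_eq
proof (intro conjI ballI)
  show "f \<circ> g permutes pverts X"
    using assms by (simp add: automorphisms_def permutes_compose)
  fix x y assume xy: "x \<in> pverts X" "y \<in> pverts X"
  then have "(x, y) \<in> parcs X \<longleftrightarrow> (g x, g y) \<in> parcs X"
    using assms(2) by (simp add: automorphisms_def)
  also have "\<dots> \<longleftrightarrow> (f (g x), f (g y)) \<in> parcs X"
    using assms(1) xy[THEN automorphism_in_pverts[OF assms(2)]] by (simp add: automorphisms_def)
  finally show "(x, y) \<in> parcs X \<longleftrightarrow> ((f \<circ> g) x, (f \<circ> g) y) \<in> parcs X" by simp
qed

lemma vertex_transitive_automorphism: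
  assumes "vertex_transitive X" "u \<in> pverts X" "v \<in> pverts X"
  shows "\<exists>f \<in> automorphisms X. f u = v"
proof -
  obtain f where f: "bij_betw f (pverts X) (pverts X)" "f u = v"
    "\<forall>x \<in> pverts X. \<forall>y \<in> pverts X. (x, y) \<in> parcs X \<longleftrightarrow> (f x, f y) \<in> parcs X"
    using assms unfolding vertex_transitive_def by meson
  \<comment> \<open>The map supplied by transitivity is arbitrary off the vertex set;
    \<open>g\<close> normalises it to the identity there.\<close>
  define g where "g = (\<lambda>x. if x \<in> pverts X then f x else x)"
  have "bij_betw g (pverts X) (pverts X)"
    using f(1) by (rule bij_betw_cong[THEN iffD1, rotated]) (simp add: g_def)
  then have "g permutes pverts X" by (rule bij_imp_permutes) (simp add: g_def)
  then have "g \<in> automorphisms X" using f(3) by (simp add: automorphisms_def g_def)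
  moreover have "g u = v" using f(2) assms(2) by (simp add: g_def)
  ultimately show ?thesis by blast
qed

text \<open>Composing with an automorphism that takes \<open>a\<close> to \<open>a'\<close> injects
  the first set into the second. Exchanging \<open>a\<close> and \<open>a'\<close> gives
  equality.\<close>

lemma card_automorphisms_mapping_le:
  assumes "finite (pverts X)" "vertex_transitive X" "a \<in> pverts X" "a' \<in> pverts X"
  shows "card {f \<in> automorphisms X. f b = a} \<le> card {f \<in> automorphisms X. f b = a'}"
proof -
  obtain t where t: "t \<in> automorphisms X" "t a = a'"
    using vertex_transitive_automorphism[OF assms(2-4)] by blast
  have inj: "inj t" using t by (auto simp: automorphisms_def intro: permutes_inj)
  show ?thesis
  proof (rule card_inj_on_le[where f = "\<lambda>f. t \<circ> f"])
    show "inj_on (\<lambda>f. t \<circ> f) {f \<in> automorphisms X. f b = a}"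
      using inj by (auto simp: inj_on_def fun_eq_iff)
    show "(\<lambda>f. t \<circ> f) ` {f \<in> automorphisms X. f b = a} \<subseteq> {f \<in> automorphisms X. f b = a'}"
      using t by (auto intro: comp_in_automorphisms)
    show "finite {f \<in> automorphisms X. f b = a'}" using finite_automorphisms[OF assms(1)] by simp
  qed
qed

text \<open>Orbit-stabiliser in counting form: the automorphisms are partitioned by the image of
  \<open>b\<close>, and all classes have the same size.\<close>

lemma card_automorphisms_mapping:
  assumes "finite (pverts X)" "vertex_transitive X" "a \<in> pverts X" "b \<in> pverts X"
  shows "card (pverts X) * card {f \<in> automorphisms X. f b = a} = card (automorphisms X)"
proof -
  have "card (automorphisms X) = card (\<Union>c\<in>pverts X. {f \<in> automorphisms X. f b = c})"
    using automorphism_in_pverts[OF _ assms(4)] by (intro arg_cong[where f = card]) auto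
  also have "\<dots> = (\<Sum>c\<in>pverts X. card {f \<in> automorphisms X. f b = c})"
    by (rule card_UN_disjoint) (use assms finite_automorphisms[OF assms(1)] in auto)
  also have "\<dots> = (\<Sum>c\<in>pverts X. card {f \<in> automorphisms X. f b = a})"
    by (intro sum.cong refl antisym card_automorphisms_mapping_le assms)
  finally show ?thesis by simp
qed

text \<open>For fixed \<open>b\<close>, the image \<open>f b\<close> is uniformly distributed over
  the vertices as \<open>f\<close> runs through the automorphisms. Summing over \<open>b\<close> in
  \<open>B\<close> after exchanging the sums gives the identity, stated without division.\<close>

lemma sum_over_automorphisms:
  fixes w :: "'a \<Rightarrow> nat"
  assumes "finite (pverts X)" "vertex_transitive X" "B \<subseteq> pverts X"
  shows "card (pverts X) * (\<Sum>f\<in>automorphisms X. \<Sum>b\<in>B. w (f b)) =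
    card (automorphisms X) * card B * (\<Sum>a\<in>pverts X. w a)"
proof -
  let ?A = "automorphisms X" and ?V = "pverts X"
  have fin: "finite ?A" by (rule finite_automorphisms[OF assms(1)])
  have *: "card ?V * (\<Sum>f\<in>?A. w (f b)) = card ?A * (\<Sum>a\<in>?V. w a)" if "b \<in> ?V" for b
  proof -
    have "(\<Sum>f\<in>?A. w (f b)) = (\<Sum>a\<in>?V. \<Sum>f\<in>{f \<in> ?A. f b = a}. w (f b))"
      by (rule sum.group[symmetric]) (use fin assms(1) automorphism_in_pverts that in auto)
    also have "\<dots> = (\<Sum>a\<in>?V. card {f \<in> ?A. f b = a} * w a)"
      by (intro sum.cong) auto
    finally have "card ?V * (\<Sum>f\<in>?A. w (f b)) =
        (\<Sum>a\<in>?V. (card ?V * card {f \<in> ?A. f b = a}) * w a)"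
      by (simp add: sum_distrib_left mult.assoc)
    also have "\<dots> = (\<Sum>a\<in>?V. card ?A * w a)"
      by (intro sum.cong refl) (simp add: card_automorphisms_mapping[OF assms(1,2) _ that])
    finally show ?thesis by (simp add: sum_distrib_left)
  qed
  have "card ?V * (\<Sum>f\<in>?A. \<Sum>b\<in>B. w (f b)) = (\<Sum>b\<in>B. card ?V * (\<Sum>f\<in>?A. w (f b)))"
    by (subst sum.swap) (simp add: sum_distrib_left)
  also have "\<dots> = (\<Sum>b\<in>B. card ?A * (\<Sum>a\<in>?V. w a))"
    using assms(3) * by (intro sum.cong) auto
  finally show ?thesis by simp
qed

text \<open>By \<open>ge\<close> the average of the inner sums over all automorphisms is at least
  \<open>m\<close>, while by \<open>le\<close> none exceeds \<open>m\<close>. Hence every one of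
  them equals \<open>m\<close>, and \<open>ge\<close> is an equality.\<close>

lemma sum_automorphism_eq_of_le:
  fixes w :: "'a \<Rightarrow> nat"
  assumes "finite (pverts X)" "vertex_transitive X" "B \<subseteq> pverts X" "pverts X \<noteq> {}"
    and le: "\<And>f. f \<in> automorphisms X \<Longrightarrow> (\<Sum>b\<in>B. w (f b)) \<le> m"
    and ge: "card (pverts X) * m \<le> card B * (\<Sum>a\<in>pverts X. w a)"
    and f: "f \<in> automorphisms X"
  shows "(\<Sum>b\<in>B. w (f b)) = m"
    and "card (pverts X) * m = card B * (\<Sum>a\<in>pverts X. w a)"
proof -
  let ?A = "automorphisms X" and ?V = "pverts X"
  have fin: "finite ?A" by (rule finite_automorphisms[OF assms(1)])
  have V: "card ?V > 0" using assms by (simp add: card_gt_0_iff)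
  have A: "card ?A > 0" using fin f by (auto simp: card_gt_0_iff)
  have S: "card ?V * (\<Sum>f\<in>?A. \<Sum>b\<in>B. w (f b)) = card ?A * (card B * (\<Sum>a\<in>?V. w a))"
    by (simp add: sum_over_automorphisms[OF assms(1-3)])
  also have "\<dots> \<ge> card ?A * (card ?V * m)" using ge by simp
  finally have "card ?V * (card ?A * m) \<le> card ?V * (\<Sum>f\<in>?A. \<Sum>b\<in>B. w (f b))"
    by (simp add: ac_simps)
  then have "card ?A * m \<le> (\<Sum>f\<in>?A. \<Sum>b\<in>B. w (f b))" using V by simp
  moreover have "(\<Sum>f\<in>?A. \<Sum>b\<in>B. w (f b)) \<le> (\<Sum>f\<in>?A. m)" using le by (rule sum_mono)
  ultimately have eq: "(\<Sum>f\<in>?A. \<Sum>b\<in>B. w (f b)) = (\<Sum>f\<in>?A. m)" by simp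
  show "(\<Sum>b\<in>B. w (f b)) = m"
    by (rule sum_mono_inv[OF eq le f fin])
  have "card ?A * (card ?V * m) = card ?A * (card B * (\<Sum>a\<in>?V. w a))"
    using S eq by (simp add: ac_simps)
  then show "card ?V * m = card B * (\<Sum>a\<in>?V. w a)" using A by simp
qed

text \<open>For a maximum independent set \<open>I\<close>, the set of points of \<open>B\<close>
  that an automorphism sends into \<open>I\<close> is independent. Its average size is
  \<open>card B\<close> times the independence ratio, so some automorphism reaches that
  size.\<close>

lemma ex_large_independent_subset:
  assumes "finite (pverts X)" "vertex_transitive X" "B \<subseteq> pverts X"
  shows "\<exists>J. independent_set X J \<and> J \<subseteq> B \<and> independence_ratio X * card B \<le> card J"
proof (rule ccontr)
  assume neg: "\<not> ?thesis"
  let ?A = "automorphisms X" and ?V = "pverts X"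
  have fin: "finite ?A" by (rule finite_automorphisms[OF assms(1)])
  have finB: "finite B" using assms finite_subset by blast
  obtain I where I: "maximum_independent_set X I"
    using ex_maximum_independent_set[OF assms(1)] by blast
  have IV: "I \<subseteq> ?V" using I by (simp add: maximum_independent_set_def independent_set_def)
  define w :: "'a \<Rightarrow> nat" where "w = (\<lambda>a. if a \<in> I then 1 else 0)"
  have less: "real (\<Sum>b\<in>B. w (f b)) < independence_ratio X * card B" if f: "f \<in> ?A" for f
  proof -
    have "(\<Sum>b\<in>B. w (f b)) = card {b \<in> B. f b \<in> I}"
      using finB by (simp add: w_def sum.If_cases Int_def)
    moreover have "independent_set X {b \<in> B. f b \<in> I}"
    proof -
      have "(u, v) \<notin> parcs X" if "u \<in> B" "v \<in> B" "f u \<in> I" "f v \<in> I" for u v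
      proof -
        have "(f u, f v) \<notin> parcs X"
          using I that by (simp add: independent_set_def maximum_independent_set_def)
        then show ?thesis using f that assms(3) by (auto simp: automorphisms_def)
      qed
      then show ?thesis using assms(3) by (auto simp: independent_set_def)
    qed
    ultimately show ?thesis using neg by (smt (verit) mem_Collect_eq subsetI)
  qed
  have "card ?V * (\<Sum>f\<in>?A. \<Sum>b\<in>B. w (f b)) = card ?A * card B * card I"
    using sum_over_automorphisms[OF assms, of w] IV assms(1)
    by (simp add: w_def sum.If_cases Int_absorb1)
  then have "real (card ?V) * (\<Sum>f\<in>?A. real (\<Sum>b\<in>B. w (f b))) = real (card ?A) * card B * card I"
    by (metis of_nat_mult of_nat_sum)
  moreover have "(\<Sum>f\<in>?A. real (\<Sum>b\<in>B. w (f b))) < (\<Sum>f\<in>?A. independence_ratio X * card B)"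
    by (rule sum_strict_mono[OF fin _ less]) (use id_in_automorphisms in auto)
  moreover have "real (card I) = independence_ratio X * card ?V"
    using I independence_number_eq_ratio[OF assms(1)] by (simp add: maximum_independent_set_def)
  \<comment> \<open>For empty \<open>B\<close> the strict inequality \<open>less\<close> would read
    0 < 0. A vertex therefore exists, which keeps the averaged inequality strict after
    multiplication by \<open>card ?V\<close>.\<close>
  moreover have "B \<noteq> {}" using less[OF id_in_automorphisms] by auto
  then have "card ?V > 0" using assms by (auto simp: card_gt_0_iff)
  ultimately show False by (simp add: ac_simps)
qed

section \<open>The ratio bound for closed neighbourhoods\<close>

lemma closed_neighbourhood_subset:
  "independent_set X A \<Longrightarrow> closed_neighbourhood X A \<subseteq> pverts X"
  by (auto simp: closed_neighbourhood_def independent_set_def)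

text \<open>A large independent set of the complement of \<open>N[A]\<close> can be added to \<open>A\<close>.\<close>

lemma card_le_ratio_closed_neighbourhood:
  assumes "pair_graph X" "vertex_transitive X" "independent_set X A"
  shows "card A \<le> independence_ratio X * card (closed_neighbourhood X A)"
proof -
  interpret pair_graph X by fact
  have fin: "finite (pverts X)" by (rule pair_finite_verts)
  let ?N = "closed_neighbourhood X A"
  have N: "?N \<subseteq> pverts X" by (rule closed_neighbourhood_subset[OF assms(3)])
  obtain J where J: "independent_set X J" "J \<subseteq> pverts X - ?N"
    "independence_ratio X * card (pverts X - ?N) \<le> card J"
    using ex_large_independent_subset[OF fin assms(2), of "pverts X - ?N"] by auto
  have "independent_set X (A \<union> J)"
  proof -
    have "(a, b) \<notin> parcs X" "(b, a) \<notin> parcs X" if "a \<in> A" "b \<in> J" for a b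
      using that J(2) arcs_symmetric by (auto simp: closed_neighbourhood_def)
    then show ?thesis
      using J(1) assms(3) by (auto simp: independent_set_def)
  qed
  then have "card (A \<union> J) \<le> independence_number X"
    by (rule card_le_independence_number[OF fin])
  moreover have "card (A \<union> J) = card A + card J"
    using J assms(3) fin by (intro card_Un_disjoint)
      (auto simp: independent_set_def closed_neighbourhood_def intro: finite_subset)
  ultimately have "real (card A) + card J \<le> independence_ratio X * card (pverts X)"
    using independence_number_eq_ratio[OF fin] by (metis of_nat_add of_nat_le_iff)
  moreover have "real (card (pverts X - ?N)) = real (card (pverts X)) - card ?N"
    using N fin by (simp add: card_Diff_subset finite_subset of_nat_diff card_mono)
  ultimately show ?thesis using J(3) by (simp add: right_diff_distrib)
qed

section \<open>Imprimitive independent sets\<close>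

text \<open>With r the independence ratio, the chain |A| \<le> r|N[A]| \<le> r|C| \<le> |A|
  collapses to equalities, so a set \<open>C\<close> enclosing N[A] can stand in for N[A] itself.
  Properness of \<open>C\<close> makes |A| smaller than the independence number.\<close>

lemma imprimitive_independent_setI:
  assumes "pair_graph X" "vertex_transitive X" "independent_set X A" "A \<noteq> {}"
    and "closed_neighbourhood X A \<subseteq> C" "C \<subset> pverts X"
    and large: "independence_ratio X * card C \<le> card A"
  shows "imprimitive_independent_set X A"
proof -
  interpret pair_graph X by fact
  let ?N = "closed_neighbourhood X A"
  have fin: "finite (pverts X)" by (rule pair_finite_verts)
  have finC: "finite C" using assms(6) fin by (auto intro: finite_subset)
  have pos: "independence_ratio X > 0"
    using independence_ratio_pos[OF fin] assms(6) no_loops' by blast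
  have CV: "card C < card (pverts X)" using assms(6) fin by (rule psubset_card_mono[rotated])
  have NC: "card ?N \<le> card C" using assms(5) finC by (rule card_mono[rotated])
  have AN: "card A \<le> independence_ratio X * card ?N"
    by (rule card_le_ratio_closed_neighbourhood[OF assms(1-3)])
  have "independence_ratio X * card ?N \<le> independence_ratio X * card C"
    using NC pos by simp
  then have eq: "card A = independence_ratio X * card ?N"
    and "card A \<le> independence_ratio X * card C" using AN large by linarith+
  then have "card A < independence_ratio X * card (pverts X)"
    using CV pos by (smt (verit) mult_less_cancel_left_pos of_nat_less_iff)
  then have "card A < independence_number X"
    using independence_number_eq_ratio[OF fin] by simp
  moreover have "A \<subseteq> ?N" by (auto simp: closed_neighbourhood_def)
  \<comment> \<open>Needed to turn the product equation \<open>eq\<close> into the quotient of the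
    definition.\<close>
  then have "card ?N > 0" using assms(4,5) finC by (auto simp: card_gt_0_iff intro: finite_subset)
  ultimately show ?thesis
    using assms(3) eq by (simp add: imprimitive_independent_set_def)
qed

section \<open>Unions of connected components, described by closure under arcs\<close>

definition arc_closed :: "'a pair_pre_digraph \<Rightarrow> 'a set \<Rightarrow> bool" where
  "arc_closed X C \<longleftrightarrow> (\<forall>u v. (u, v) \<in> parcs X \<longrightarrow> (u \<in> C \<longleftrightarrow> v \<in> C))"

text \<open>Averaging gives an independent subset of \<open>C\<close> of size at least the ratio
  times |C|. No arc leaves \<open>C\<close>, so its closed neighbourhood stays in \<open>C\<close>,
  and \<open>imprimitive_independent_setI\<close> applies.\<close>

lemma IS_imprimitive_of_arc_closed:
  assumes "pair_graph X" "vertex_transitive X" "arc_closed X C" "C \<subset> pverts X" "C \<noteq> {}"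
  shows "IS_imprimitive X"
proof -
  interpret pair_graph X by fact
  have fin: "finite (pverts X)" by (rule pair_finite_verts)
  have pos: "independence_ratio X > 0"
    using independence_ratio_pos[OF fin] assms(4) no_loops' by blast
  have "finite C" using assms(4) fin by (auto intro: finite_subset)
  then have C: "card C > 0" using assms(5) by (simp add: card_gt_0_iff)
  obtain J where J: "independent_set X J" "J \<subseteq> C" "independence_ratio X * card C \<le> card J"
    using ex_large_independent_subset[OF fin assms(2), of C] assms(4) by auto
  have "0 < independence_ratio X * card C" using pos C by simp
  then have "J \<noteq> {}" using J(3) by auto
  moreover have "closed_neighbourhood X J \<subseteq> C"
    using J(2) assms(3) by (auto simp: closed_neighbourhood_def arc_closed_def)
  ultimately have "imprimitive_independent_set X J"
    using imprimitive_independent_setI assms J by blast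
  then show ?thesis by (auto simp: IS_imprimitive_def)
qed

text \<open>Connectedness is strong connectedness of the symmetric closure, so a walk leads from a
  vertex of \<open>C\<close> to any other vertex; by induction along the walk it never leaves
  \<open>C\<close>.\<close>

lemma connected_arc_closed:
  assumes "pair_graph X" "Digraph_Component.connected (with_proj X)"
    and "arc_closed X C" "C \<subseteq> pverts X"
  shows "C = {} \<or> C = pverts X"
proof -
  interpret pair_graph X by fact
  have "v \<in> C" if "u \<in> C" "v \<in> pverts X" for u v
  proof -
    have "u \<rightarrow>\<^sup>*\<^bsub>mk_symmetric (with_proj X)\<^esub> v"
      using assms(2,4) that by (auto simp: connected_def strongly_connected_def)
    then have "(u, v) \<in> (parcs (mk_symmetric (with_proj X)))\<^sup>*"
      by (auto simp: reachable_def intro: rtrancl_on_rtranclI)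
    then show "v \<in> C"
    proof (induction rule: rtrancl_induct)
      case base
      then show ?case using that by simp
    next
      case (step y z)
      then show ?case using assms(3) by (auto simp: parcs_mk_symmetric arc_closed_def)
    qed
  qed
  then show ?thesis using assms(4) by blast
qed

section \<open>Independent sets in direct products\<close>

lemma pverts_direct_product [simp]: "pverts (direct_product X Y) = pverts X \<times> pverts Y"
  by (simp add: direct_product_def)

lemma parcs_direct_product [simp]:
  "((u, x), (v, y)) \<in> parcs (direct_product X Y) \<longleftrightarrow> (u, v) \<in> parcs X \<and> (x, y) \<in> parcs Y"
  by (auto simp: direct_product_def)

lemma independent_set_times_pverts:
  "independent_set X I \<Longrightarrow> independent_set (direct_product X Y) (I \<times> pverts Y)"
  by (auto simp: independent_set_def)

lemma independent_set_pverts_times: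
  "independent_set Y I \<Longrightarrow> independent_set (direct_product X Y) (pverts X \<times> I)"
  by (auto simp: independent_set_def)

text \<open>Maximum independent sets \<open>I\<close> and \<open>J\<close> of the factors give the
  independent sets I x V(Y) and V(X) x J, whose densities in the product are the two ratios.\<close>

lemma max_ratio_le_independence_number_product:
  assumes "finite (pverts X)" "finite (pverts Y)"
  shows "max (independence_ratio X) (independence_ratio Y) * card (pverts X) * card (pverts Y)
    \<le> independence_number (direct_product X Y)"
proof -
  have fin: "finite (pverts (direct_product X Y))" using assms by simp
  obtain I J where I: "maximum_independent_set X I" and J: "maximum_independent_set Y J"
    using ex_maximum_independent_set[OF assms(1)] ex_maximum_independent_set[OF assms(2)] by blast
  have "card (I \<times> pverts Y) \<le> independence_number (direct_product X Y)"
    using I by (intro card_le_independence_number fin independent_set_times_pverts)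
      (simp add: maximum_independent_set_def)
  then have "real (independence_number X) * card (pverts Y) \<le> independence_number (direct_product X Y)"
    using I by (simp add: card_cartesian_product maximum_independent_set_def flip: of_nat_mult)
  moreover have "card (pverts X \<times> J) \<le> independence_number (direct_product X Y)"
    using J by (intro card_le_independence_number fin independent_set_pverts_times)
      (simp add: maximum_independent_set_def)
  then have "real (card (pverts X)) * independence_number Y \<le> independence_number (direct_product X Y)"
    using J by (simp add: card_cartesian_product maximum_independent_set_def flip: of_nat_mult)
  ultimately show ?thesis
    using independence_number_eq_ratio[OF assms(1)] independence_number_eq_ratio[OF assms(2)]
    by (simp add: max_def ac_simps)
qed

text \<open>A set of product form has at most the density of the factor that supplies it, yet a
  maximum one has at least the larger ratio. So the supplying factor has the larger ratio, and the
  size is determined.\<close>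

lemma MIS_normal_maximum_cases:
  assumes "finite (pverts X)" "finite (pverts Y)" "pverts X \<noteq> {}" "pverts Y \<noteq> {}"
    and "MIS_normal X Y" "maximum_independent_set (direct_product X Y) S"
  shows "(\<exists>I. S = I \<times> pverts Y \<and> independence_ratio Y \<le> independence_ratio X) \<or>
    (\<exists>I. maximum_independent_set Y I \<and> S = pverts X \<times> I \<and>
      independence_ratio X \<le> independence_ratio Y)"
    and "card S = max (independence_ratio X) (independence_ratio Y) * card (pverts X) * card (pverts Y)"
proof -
  let ?m = "max (independence_ratio X) (independence_ratio Y)"
  have X: "real (card (pverts X)) > 0" and Y: "real (card (pverts Y)) > 0"
    using assms by (simp_all add: card_gt_0_iff)
  have ge: "?m * card (pverts X) * card (pverts Y) \<le> card S"
    using max_ratio_le_independence_number_product[OF assms(1,2)] assms(6)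
    by (simp add: maximum_independent_set_def)
  consider I where "independent_set X I" "S = I \<times> pverts Y"
    | I where "independent_set Y I" "S = pverts X \<times> I"
    using assms(5,6) unfolding MIS_normal_def by blast
  then have "((\<exists>I. S = I \<times> pverts Y \<and> independence_ratio Y \<le> independence_ratio X) \<or>
    (\<exists>I. maximum_independent_set Y I \<and> S = pverts X \<times> I \<and>
      independence_ratio X \<le> independence_ratio Y)) \<and>
      card S = ?m * card (pverts X) * card (pverts Y)"
  proof cases
    case 1
    have "real (card I) \<le> independence_ratio X * card (pverts X)"
      using card_le_independence_number[OF assms(1) 1(1)] independence_number_eq_ratio[OF assms(1)]
      by (metis of_nat_le_iff)
    moreover have S: "real (card S) = card I * card (pverts Y)"
      using 1(2) by (simp add: card_cartesian_product)
    then have "?m * card (pverts X) \<le> card I" using ge Y by simp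
    ultimately have "?m * card (pverts X) \<le> independence_ratio X * card (pverts X)"
      and *: "card I \<le> ?m * card (pverts X)"
      using X by (smt (verit) max.cobounded1 mult_right_mono)+
    then have "?m \<le> independence_ratio X" using X by simp
    moreover have "card I = ?m * card (pverts X)"
      using * \<open>?m * card (pverts X) \<le> card I\<close> by simp
    ultimately show ?thesis using 1 S by auto
  next
    case 2
    have I: "real (card I) \<le> independence_ratio Y * card (pverts Y)"
      using card_le_independence_number[OF assms(2) 2(1)] independence_number_eq_ratio[OF assms(2)]
      by (metis of_nat_le_iff)
    have S: "real (card S) = card (pverts X) * card I"
      using 2(2) by (simp add: card_cartesian_product)
    then have "card (pverts X) * (?m * card (pverts Y)) \<le> real (card (pverts X)) * card I"
      using ge by (simp add: ac_simps)
    then have mI: "?m * card (pverts Y) \<le> card I" using X by simp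
    then have "?m * card (pverts Y) \<le> independence_ratio Y * card (pverts Y)"
      using I by linarith
    then have m: "?m = independence_ratio Y" using Y by simp
    then have c: "real (card I) = ?m * card (pverts Y)" using mI I by simp
    then have "card I = independence_number Y"
      using m independence_number_eq_ratio[OF assms(2)] by (metis of_nat_eq_iff)
    then have "maximum_independent_set Y I" using 2(1) by (simp add: maximum_independent_set_def)
    moreover have "independence_ratio X \<le> independence_ratio Y" using m by simp
    ultimately show ?thesis using 2(2) S c by (auto simp: ac_simps)
  qed
  then show "(\<exists>I. S = I \<times> pverts Y \<and> independence_ratio Y \<le> independence_ratio X) \<or>
    (\<exists>I. maximum_independent_set Y I \<and> S = pverts X \<times> I \<and>
      independence_ratio X \<le> independence_ratio Y)"
    and "card S = ?m * card (pverts X) * card (pverts Y)"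
    by blast+
qed

section \<open>Fibres of a maximum independent set over the first factor\<close>

lemma card_eq_sum_fibres:
  assumes "finite A" "finite B" "S \<subseteq> A \<times> B"
  shows "card S = (\<Sum>a\<in>A. card (S `` {a}))"
proof -
  have "S = (SIGMA a:A. S `` {a})" using assms(3) by auto
  then have "card S = card (SIGMA a:A. S `` {a})" by simp
  also have "\<dots> = (\<Sum>a\<in>A. card (S `` {a}))"
    by (rule card_SigmaI) (use assms in \<open>auto intro: finite_subset[of _ B]\<close>)
  finally show ?thesis .
qed

text \<open>Every pullback of \<open>S\<close> to G' x H is maximum by averaging, hence of product
  form. Since some automorphism moves a vertex of \<open>G'\<close> to any prescribed
  \<open>u\<close>, the fibre over \<open>u\<close> is a fibre of such a product-form set.\<close>

lemma fibres_of_maximum_independent_set: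
  assumes G: "finite (pverts G)" "vertex_transitive G" and H: "finite (pverts H)" "pverts H \<noteq> {}"
    and sub: "pverts G' \<subseteq> pverts G" "pverts G' \<noteq> {}"
      "parcs G' \<subseteq> parcs G"
    and norm: "MIS_normal G' H" and ratio: "independence_ratio G' = independence_ratio G"
    and S: "maximum_independent_set (direct_product G H) S"
  shows "u \<in> pverts G \<Longrightarrow>
      (S `` {u} \<in> {{}, pverts H} \<and> independence_ratio H \<le> independence_ratio G) \<or>
      (maximum_independent_set H (S `` {u}) \<and> independence_ratio G \<le> independence_ratio H)"
    and "card S = max (independence_ratio G) (independence_ratio H) * card (pverts G) * card (pverts H)"
proof -
  let ?m = "max (independence_ratio G) (independence_ratio H)"
  \<comment> \<open>The pullback of \<open>S\<close> along the map sending (b, h) to (f b, h),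
    restricted to the vertices of \<open>G'\<close>.\<close>
  let ?T = "\<lambda>f. SIGMA b:pverts G'. S `` {f b}"
  let ?a = "independence_number (direct_product G' H)"
  have SV: "S \<subseteq> pverts G \<times> pverts H"
    and Sind: "\<And>p q. p \<in> S \<Longrightarrow> q \<in> S \<Longrightarrow> (p, q) \<notin> parcs (direct_product G H)"
    using S by (auto simp: maximum_independent_set_def independent_set_def)
  have finG': "finite (pverts G')" using G(1) sub(1) finite_subset by blast
  have finGH': "finite (pverts (direct_product G' H))" using finG' H by simp
  have G0: "pverts G \<noteq> {}" using sub by blast
  obtain R where R: "maximum_independent_set (direct_product G' H) R"
    using ex_maximum_independent_set[OF finGH'] by blast
  \<comment> \<open>The ratios of \<open>G'\<close> and \<open>G\<close> agree, so the same
    \<open>?m\<close> governs both products.\<close>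
  have a: "real ?a = ?m * card (pverts G') * card (pverts H)"
    using MIS_normal_maximum_cases(2)[OF finG' H(1) sub(2) H(2) norm R] R ratio
    by (simp add: maximum_independent_set_def)
  have T: "independent_set (direct_product G' H) (?T f)" if "f \<in> automorphisms G" for f
    unfolding independent_set_def
  proof (intro conjI ballI)
    show "?T f \<subseteq> pverts (direct_product G' H)" using SV by auto
  next
    fix p q assume "p \<in> ?T f" "q \<in> ?T f"
    then obtain b h c k where *: "p = (b, h)" "q = (c, k)" "b \<in> pverts G'" "c \<in> pverts G'"
      "(f b, h) \<in> S" "(f c, k) \<in> S" by auto
    show "(p, q) \<notin> parcs (direct_product G' H)"
    proof
      assume "(p, q) \<in> parcs (direct_product G' H)"
      then have "(b, c) \<in> parcs G'" "(h, k) \<in> parcs H" using * by auto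
      moreover from this have "(f b, f c) \<in> parcs G"
        using that * sub by (auto simp: automorphisms_def)
      ultimately show False using Sind[OF *(5,6)] by auto
    qed
  qed
  have cardT: "card (?T f) = (\<Sum>b\<in>pverts G'. card (S `` {f b}))" for f
    by (rule card_SigmaI) (use SV H finG' in \<open>auto intro: finite_subset[of _ "pverts H"]\<close>)
  have cardS: "card S = (\<Sum>a\<in>pverts G. card (S `` {a}))"
    by (rule card_eq_sum_fibres[OF G(1) H(1) SV])
  have "?m * card (pverts G) * card (pverts H) \<le> card S"
    using max_ratio_le_independence_number_product[OF G(1) H(1)] S
    by (simp add: maximum_independent_set_def)
  then have "card (pverts G') * (?m * card (pverts G) * card (pverts H)) \<le> card (pverts G') * real (card S)"
    by (rule mult_left_mono) simp
  then have "real (card (pverts G) * ?a) \<le> real (card (pverts G') * card S)"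
    using a by (simp add: ac_simps)
  \<comment> \<open>The density of \<open>S\<close> in G x H is at least \<open>?m\<close>, the
    maximum density in G' x H; with fibre sizes as weights this is the lower bound for the averaging
    lemma.\<close>
  then have ge: "card (pverts G) * ?a \<le> card (pverts G') * (\<Sum>a\<in>pverts G. card (S `` {a}))"
    unfolding cardS of_nat_le_iff .
  have le: "(\<Sum>b\<in>pverts G'. card (S `` {f b})) \<le> ?a" if "f \<in> automorphisms G" for f
    using card_le_independence_number[OF finGH' T[OF that]] cardT by simp
  note avg = sum_automorphism_eq_of_le[where w = "\<lambda>a. card (S `` {a})",
      OF G sub(1) G0 le ge]
  \<comment> \<open>The equality does not involve the automorphism, so the identity serves as
    witness.\<close>
  have "card (pverts G) * ?a = card (pverts G') * card S"
    unfolding cardS by (rule avg(2)[OF _ id_in_automorphisms])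
  then have "card (pverts G') * real (card S) = card (pverts G) * real ?a"
    by (metis of_nat_mult)
  also have "card (pverts G) * real ?a = card (pverts G') * (?m * card (pverts G) * card (pverts H))"
    unfolding a by (simp add: ac_simps)
  finally have "card (pverts G') * real (card S) =
      card (pverts G') * (?m * card (pverts G) * card (pverts H))" .
  moreover have "real (card (pverts G')) \<noteq> 0" using finG' sub by simp
  ultimately show "card S = ?m * card (pverts G) * card (pverts H)"
    unfolding mult_cancel_left by blast
  show "(S `` {u} \<in> {{}, pverts H} \<and> independence_ratio H \<le> independence_ratio G) \<or>
      (maximum_independent_set H (S `` {u}) \<and> independence_ratio G \<le> independence_ratio H)"
    if u: "u \<in> pverts G"
  proof -
    obtain b where b: "b \<in> pverts G'" using sub by blast
    obtain f where f: "f \<in> automorphisms G" "f b = u"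
      using vertex_transitive_automorphism[OF G(2)] b sub(1) u by blast
    have "card (?T f) = ?a" using avg(1)[OF _ f(1)] cardT by simp
    then have "maximum_independent_set (direct_product G' H) (?T f)"
      using T[OF f(1)] by (simp add: maximum_independent_set_def)
    then have "(\<exists>I. ?T f = I \<times> pverts H \<and> independence_ratio H \<le> independence_ratio G) \<or>
      (\<exists>I. maximum_independent_set H I \<and> ?T f = pverts G' \<times> I \<and>
        independence_ratio G \<le> independence_ratio H)"
      using MIS_normal_maximum_cases(1)[OF finG' H(1) sub(2) H(2) norm] ratio by simp
    moreover have fib: "S `` {u} = ?T f `` {b}" using b f by auto
    have "S `` {u} \<in> {{}, pverts H}" if "?T f = I \<times> pverts H" for I
      unfolding fib that by auto
    moreover have "S `` {u} = I" if "?T f = pverts G' \<times> I" for I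
      unfolding fib that using b by auto
    ultimately show ?thesis by blast
  qed
qed

text \<open>The product has no arcs, so its whole vertex set is the only maximum independent set,
  and it has product form through the arcless factor.\<close>

lemma MIS_normal_of_no_arcs:
  assumes "finite (pverts X)" "finite (pverts Y)" "parcs X = {} \<or> parcs Y = {}"
  shows "MIS_normal X Y"
  unfolding MIS_normal_def
proof (intro allI impI)
  fix S assume S: "maximum_independent_set (direct_product X Y) S"
  let ?V = "pverts X \<times> pverts Y"
  have "parcs (direct_product X Y) = {}" using assms(3) by (auto simp: direct_product_def)
  then have "independent_set (direct_product X Y) ?V" by (simp add: independent_set_def)
  then have "card ?V \<le> card S"
    using card_le_independence_number[of "direct_product X Y" ?V] S assms
    by (simp add: maximum_independent_set_def)
  moreover have "S \<subseteq> ?V" using S by (auto simp: maximum_independent_set_def independent_set_def)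
  ultimately have "S = ?V" using assms by (intro card_seteq) auto
  moreover have "independent_set X (pverts X) \<or> independent_set Y (pverts Y)"
    using assms(3) by (auto simp: independent_set_def)
  ultimately show "(\<exists>I. independent_set X I \<and> S = I \<times> pverts Y) \<or>
    (\<exists>I. independent_set Y I \<and> S = pverts X \<times> I)" by blast
qed

lemma vertex_transitive_ex_neighbour:
  assumes "pair_graph X" "vertex_transitive X" "parcs X \<noteq> {}" "v \<in> pverts X"
  shows "\<exists>w. (v, w) \<in> parcs X"
proof -
  interpret pair_graph X by fact
  obtain x y where xy: "(x, y) \<in> parcs X" using assms(3) by auto
  then have V: "x \<in> pverts X" "y \<in> pverts X" using wellformed' by auto
  obtain f where "f \<in> automorphisms X" "f x = v"
    using vertex_transitive_automorphism[OF assms(2) V(1) assms(4)] by blast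
  then show ?thesis using xy V by (auto simp: automorphisms_def)
qed

section \<open>The trichotomy\<close>

theorem theorem3p1:
  fixes G :: "'a pair_pre_digraph" and H :: "'b pair_pre_digraph"
  assumes "pair_graph G" and "vertex_transitive G"
    and "pair_graph H" and "vertex_transitive H"
    and "\<exists>G' :: 'a pair_pre_digraph. induced_subgraph (with_proj G') (with_proj G) \<and>
           MIS_normal G' H \<and> independence_ratio G' = independence_ratio G"
  shows "MIS_normal G H \<or>
         (independence_ratio G = independence_ratio H \<and> IS_imprimitive G) \<or>
         (independence_ratio G < independence_ratio H \<and> \<not> Digraph_Component.connected (with_proj G))"
proof (cases "parcs G = {} \<or> parcs H = {}")
  case True
  then show ?thesis
    using assms(1,3) MIS_normal_of_no_arcs
    by (metis pair_fin_digraph.pair_finite_verts pair_graph_def pair_digraph_def)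
next
  case False
  interpret G: pair_graph G by fact
  interpret H: pair_graph H by fact
  let ?r = "independence_ratio G" and ?V = "pverts G" and ?W = "pverts H"
  have finG: "finite ?V" and finH: "finite ?W" using G.pair_finite_verts H.pair_finite_verts by auto
  have G0: "?V \<noteq> {}" and H0: "?W \<noteq> {}"
    using False G.wellformed' H.wellformed' by fastforce+
  obtain G' :: "'a pair_pre_digraph" where G': "pverts G' \<subseteq> ?V" "parcs G' \<subseteq> parcs G"
    "MIS_normal G' H" "independence_ratio G' = ?r"
    using assms(5) by (auto simp: induced_subgraph_def subgraph_def)
  have r: "?r > 0" using independence_ratio_pos[OF finG G0] G.no_loops' by blast
  \<comment> \<open>An empty \<open>G'\<close> would have the default ratio 0, whereas
    \<open>?r\<close> is positive.\<close>
  have G'0: "pverts G' \<noteq> {}" using r G'(4) by (auto simp: independence_ratio_def)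
  note fibres = fibres_of_maximum_independent_set[OF finG assms(2) finH H0 G'(1) G'0 G'(2-4)]
  show ?thesis
  proof (cases "MIS_normal G H")
    case True
    then show ?thesis by blast
  next
    case nonnormal: False
    then obtain S where S: "maximum_independent_set (direct_product G H) S"
      and n1: "\<And>I. independent_set G I \<Longrightarrow> S \<noteq> I \<times> ?W"
      and n2: "\<And>I. independent_set H I \<Longrightarrow> S \<noteq> ?V \<times> I"
      unfolding MIS_normal_def by blast
    have SV: "S \<subseteq> ?V \<times> ?W"
      and Sind: "\<And>u v x y. (u, x) \<in> S \<Longrightarrow> (v, y) \<in> S \<Longrightarrow> (u, v) \<in> parcs G \<Longrightarrow> (x, y) \<notin> parcs H"
      using S unfolding maximum_independent_set_def independent_set_def
      by auto fastforce
    \<comment> \<open>\<open>I\<close> collects the full fibres and \<open>B\<close> the maximum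
      independent ones; by \<open>fibres\<close> all other fibres are empty.\<close>
    define I where "I = {u \<in> ?V. S `` {u} = ?W}"
    define B where "B = {u \<in> ?V. maximum_independent_set H (S `` {u})}"
    obtain x y where xy: "(x, y) \<in> parcs H" using False by auto
    then have xyW: "x \<in> ?W" "y \<in> ?W" using H.wellformed' by auto
    \<comment> \<open>Over adjacent vertices of \<open>I\<close>, the full fibres would contain the
      two ends of the arc \<open>(x, y)\<close>, giving adjacent elements of
      \<open>S\<close>.\<close>
    have Iind: "independent_set G I"
      using Sind xy xyW unfolding independent_set_def I_def by blast
    have W_not: "\<not> independent_set H ?W" using xy xyW by (auto simp: independent_set_def)
    have IB: "I \<inter> B = {}" using W_not by (auto simp: I_def B_def maximum_independent_set_def)
    have Bne: "\<exists>u \<in> ?V. u \<in> B"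
    proof (rule ccontr)
      assume "\<not> ?thesis"
      then have "S `` {u} = {} \<or> S `` {u} = ?W" if "u \<in> ?V" for u
        using fibres(1)[OF S that] that by (auto simp: B_def)
      then have "S = I \<times> ?W" using SV by (auto simp: I_def)
      then show False using n1[OF Iind] by simp
    qed
    \<comment> \<open>A fibre over \<open>B\<close> is not full, as \<open>?W\<close> contains an
      arc, and not empty, as the independence number of \<open>H\<close> is positive. Only the
      second alternative of \<open>fibres\<close> remains.\<close>
    then have le: "?r \<le> independence_ratio H"
      using fibres(1)[OF S] W_not H0 independence_ratio_pos[OF finH H0] H.no_loops'
        independence_number_eq_ratio[OF finH]
      by (fastforce simp: B_def maximum_independent_set_def card_eq_0_iff)
    have eq_fibre: "S `` {u} = S `` {v}" if "u \<in> B" "v \<in> B" "(u, v) \<in> parcs G" for u v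
    proof (rule maximum_independent_sets_eq[OF finH])
      show "maximum_independent_set H (S `` {u})" "maximum_independent_set H (S `` {v})"
        using that by (auto simp: B_def)
      show "(x, y) \<notin> parcs H \<and> (y, x) \<notin> parcs H" if "x \<in> S `` {u}" "y \<in> S `` {v}" for x y
        using that \<open>(u, v) \<in> parcs G\<close> Sind H.arcs_symmetric by blast
    qed
    \<comment> \<open>The vertices with the same fibre as \<open>u\<close> form an arc-closed class
      by \<open>eq_fibre\<close>. It is proper, since a constant fibre would give \<open>S\<close>
      the second product form.\<close>
    have split: "\<exists>C. arc_closed G C \<and> C \<subset> ?V \<and> C \<noteq> {}" if VB: "?V \<subseteq> B"
    proof -
      obtain u where u: "u \<in> ?V" using G0 by blast
      let ?C = "{v \<in> ?V. S `` {v} = S `` {u}}"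
      have "arc_closed G ?C"
        using eq_fibre VB G.wellformed' unfolding arc_closed_def by blast
      moreover have "?C \<noteq> ?V"
      proof
        assume "?C = ?V"
        then have "S = ?V \<times> S `` {u}" using SV by auto
        moreover have "independent_set H (S `` {u})"
          using VB u by (auto simp: B_def maximum_independent_set_def)
        ultimately show False using n2 by blast
      qed
      ultimately show ?thesis using u by blast
    qed
    show ?thesis
    proof (cases "?r < independence_ratio H")
      case True
      \<comment> \<open>The strict inequality excludes the first alternative of
        \<open>fibres\<close> at every vertex.\<close>
      then have "?V \<subseteq> B" using fibres(1)[OF S] by (fastforce simp: B_def)
      then obtain C where "arc_closed G C" "C \<subset> ?V" "C \<noteq> {}" using split by blast
      then have "\<not> Digraph_Component.connected (with_proj G)"
        using connected_arc_closed[OF assms(1)] by blast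
      then show ?thesis using True by blast
    next
      case False
      then have req: "independence_ratio H = ?r" using le by simp
      have "card S = (\<Sum>u\<in>?V. card (S `` {u}))" by (rule card_eq_sum_fibres[OF finG finH SV])
      \<comment> \<open>Each full fibre contributes |V(H)| and each fibre over \<open>B\<close>
        contributes r|V(H)|. Comparing with the known size of \<open>S\<close> and cancelling |V(H)|
        yields |I| = r(|V(G)| - |B|).\<close>
      also have "\<dots> = (\<Sum>u\<in>?V. (if u \<in> I then card ?W else 0) +
          (if u \<in> B then independence_number H else 0))"
      proof (rule sum.cong[OF refl])
        fix u assume u: "u \<in> ?V"
        show "card (S `` {u}) = (if u \<in> I then card ?W else 0) +
            (if u \<in> B then independence_number H else 0)"
          using fibres(1)[OF S u] u IB by (auto simp: I_def B_def maximum_independent_set_def)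
      qed
      also have "\<dots> = card I * card ?W + card B * independence_number H"
        using finG by (simp add: sum.distrib sum.If_cases I_def B_def Int_def)
      finally have "real (card S) = card I * card ?W + card B * (?r * card ?W)"
        using independence_number_eq_ratio[OF finH] req by simp
      then have "(card I + card B * ?r) * card ?W = (?r * card ?V) * card ?W"
        using fibres(2)[OF S] req by (simp add: algebra_simps)
      moreover have "real (card ?W) \<noteq> 0" using finH H0 by simp
      ultimately have "card I + card B * ?r = ?r * card ?V" unfolding mult_cancel_right by blast
      then have count: "card I = ?r * card ?V - ?r * card B" by (simp add: algebra_simps)
      have "IS_imprimitive G"
      proof (cases "I = {}")
        case True
        then have "real (card ?V) = card B" using count r by simp
        then have "?V \<subseteq> B"
          using card_seteq[OF finG, of B] by (auto simp: B_def)
        then show ?thesis using split IS_imprimitive_of_arc_closed[OF assms(1,2)] by blast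
      next
        case False
        \<comment> \<open>A fibre over \<open>B\<close> contains some \<open>h\<close>, which has a
          neighbour \<open>k\<close> in \<open>H\<close>. The full fibre over \<open>u\<close>
          contains \<open>k\<close>, so \<open>S\<close> would contain the adjacent pairs
          \<open>(u, k)\<close> and \<open>(v, h)\<close>.\<close>
        have fibre_adj: "v \<notin> B" if "u \<in> I" "(u, v) \<in> parcs G" for u v
        proof
          assume v: "v \<in> B"
          have "S `` {v} \<noteq> {}"
          proof
            assume "S `` {v} = {}"
            then have "independence_number H = 0"
              using v by (simp add: B_def maximum_independent_set_def)
            then have "independence_ratio H = 0" by (simp add: independence_ratio_def)
            then show False using r req by simp
          qed
          then obtain h where h: "(v, h) \<in> S" by auto
          then have "h \<in> ?W" using SV by auto
          then obtain k where k: "(h, k) \<in> parcs H"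
            using vertex_transitive_ex_neighbour[OF assms(3,4)] xy by blast
          then have "(u, k) \<in> S" using that(1) H.wellformed' by (auto simp: I_def)
          then show False using Sind h that(2) k H.arcs_symmetric by blast
        qed
        \<comment> \<open>The enclosing set for \<open>imprimitive_independent_setI\<close> is
          \<open>?V - B\<close>: it is proper because \<open>B\<close> is nonempty, and
          \<open>count\<close> gives it exactly the required size.\<close>
        have "closed_neighbourhood G I \<subseteq> ?V - B"
          using fibre_adj IB by (auto simp: closed_neighbourhood_def I_def)
        moreover have "?V - B \<subset> ?V" using Bne by blast
        moreover have BV: "B \<subseteq> ?V" by (auto simp: B_def)
        then have "real (card (?V - B)) = real (card ?V) - card B"
          using finG by (simp add: card_Diff_subset finite_subset of_nat_diff card_mono)
        then have "?r * card (?V - B) \<le> card I"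
          using count by (simp add: right_diff_distrib)
        ultimately have "imprimitive_independent_set G I"
          using imprimitive_independent_setI[OF assms(1,2) Iind False] by blast
        then show ?thesis by (auto simp: IS_imprimitive_def)
      qed
      then show ?thesis using req by simp
    qed
  qed
qed

end
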